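(* Suppose that the modal logic $\Lambda$ is axiomatizable over $\mathrm{EM}$ by closed formulas and formulas of the form $\alpha(p)\to\Diamond p$, where $\alpha(p)$ is a positive formula; that is, $\Lambda$ is the smallest modal logic containing $\mathrm{EM}\cup\Gamma$ for some (possibly infinite) set $\Gamma$ each of whose members is either a closed formula or a formula $\alpha(p)\to\Diamond p$ with $\alpha(p)$ positive. Then $\Lambda$ has the Lyndon interpolation property (LIP) and the Lyndon positivity property (LPP).
   Context: Formulas. Fix a countably infinite set $\mathcal V$ of propositional variables. A literal is a variable $p$ or its negation $\neg p$. Modal formulas are built from literals and $\bot,\top$ using $\wedge,\vee,\Diamond,\Box$; negation of an arbitrary formula is defined by the duality laws, and $\varphi\to\psi$ is $\neg\varphi\vee\psi$. $\mathrm{lits}(\varphi)$ is the set of literals occurring in $\varphi$ (so $\mathrm{lits}(\neg p)=\{\neg p\}$). $\varphi(\vec p,\bar r)$ means that all variables of $\varphi$ are among $\vec p,\bar r$ (in particular $\alpha(p)$ contains no variable other than $p$); substitution is simultaneous with negations expanded. A formula is closed if it contains no variables, and positive if it contains no negated variable. Logics. A modal logic is a set $\Lambda$ of formulas containing all classical tautologies and closed under modus ponens, uniform substitution and the rule: from $\varphi\leftrightarrow\psi$ infer $\Diamond\varphi\leftrightarrow\Diamond\psi$. $\Lambda\vdash\varphi$ means $\varphi\in\Lambda$. $\mathrm{EM}$ is the smallest modal logic containing $\Diamond p\to\Diamond(p\vee q)$; a logic is monotone if it contains $\mathrm{EM}$. LIP. $\Lambda$ has LIP if whenever $\Lambda\vdash\varphi\to\psi$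 there is a formula $\iota$ with $\mathrm{lits}(\iota)\subseteq\mathrm{lits}(\varphi)\cap\mathrm{lits}(\psi)$, $\Lambda\vdash\varphi\to\iota$ and $\Lambda\vdash\iota\to\psi$. LPP. Let $\vec p=(p_i)_{i<n}$, $\bar r=(r_j)_{j<m}$ be finite tuples of pairwise distinct variables. A formula $\varphi(\vec p,\bar r)$ is $\vec p$-positive if no $\neg p_i$ is in $\mathrm{lits}(\varphi)$. It is $\vec p$-monotone in $\Lambda$ if $\Lambda\vdash\varphi(\vec p,\bar r)\to\varphi(\vec p\vee\vec q,\bar r)$, where $\vec q=(q_i)_{i<n}$ is a tuple of fresh distinct variables and $\vec p\vee\vec q=(p_i\vee q_i)_{i<n}$. A monotone logic $\Lambda$ has LPP if for all such $\vec p,\bar r$, every formula $\varphi(\vec p,\bar r)$ that is $\vec p$-monotone in $\Lambda$ is $\Lambda$-equivalent (i.e. $\Lambda\vdash\varphi\leftrightarrow\beta$) to some $\vec p$-positive formula $\beta(\vec p,\bar r)$. *)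

theory Defs
  imports Complex_Main
begin

datatype lit = PosL nat | NegL nat

datatype fm =
    Lit lit
  | Bot
  | Top
  | And fm fm
  | Or fm fm
  | Dia fm
  | Box fm

abbreviation Var :: "nat \<Rightarrow> fm" where
  "Var p \<equiv> Lit (PosL p)"

fun neg_lit :: "lit \<Rightarrow> lit" where
  "neg_lit (PosL p) = NegL p"
| "neg_lit (NegL p) = PosL p"

fun var_of :: "lit \<Rightarrow> nat" where
  "var_of (PosL p) = p"
| "var_of (NegL p) = p"

fun neg :: "fm \<Rightarrow> fm" where
  "neg (Lit l) = Lit (neg_lit l)"
| "neg Bot = Top"
| "neg Top = Bot"
| "neg (And \<phi> \<psi>) = Or (neg \<phi>) (neg \<psi>)"
| "neg (Or \<phi> \<psi>) = And (neg \<phi>) (neg \<psi>)"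
| "neg (Dia \<phi>) = Box (neg \<phi>)"
| "neg (Box \<phi>) = Dia (neg \<phi>)"

definition Imp :: "fm \<Rightarrow> fm \<Rightarrow> fm" where
  "Imp \<phi> \<psi> = Or (neg \<phi>) \<psi>"

definition Iff :: "fm \<Rightarrow> fm \<Rightarrow> fm" where
  "Iff \<phi> \<psi> = And (Imp \<phi> \<psi>) (Imp \<psi> \<phi>)"

fun lits :: "fm \<Rightarrow> lit set" where
  "lits (Lit l) = {l}"
| "lits Bot = {}"
| "lits Top = {}"
| "lits (And \<phi> \<psi>) = lits \<phi> \<union> lits \<psi>"
| "lits (Or \<phi> \<psi>) = lits \<phi> \<union> lits \<psi>"
| "lits (Dia \<phi>) = lits \<phi>"
| "lits (Box \<phi>) = lits \<phi>"

definition vars :: "fm \<Rightarrow> nat set" where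
  "vars \<phi> = var_of ` lits \<phi>"

definition closed_fm :: "fm \<Rightarrow> bool" where
  "closed_fm \<phi> \<longleftrightarrow> vars \<phi> = {}"

definition positive_in :: "nat set \<Rightarrow> fm \<Rightarrow> bool" where
  "positive_in P \<phi> \<longleftrightarrow> (\<forall>p\<in>P. NegL p \<notin> lits \<phi>)"

definition positive :: "fm \<Rightarrow> bool" where
  "positive \<phi> \<longleftrightarrow> positive_in UNIV \<phi>"

fun subst :: "(nat \<Rightarrow> fm) \<Rightarrow> fm \<Rightarrow> fm" where
  "subst \<sigma> (Lit (PosL p)) = \<sigma> p"
| "subst \<sigma> (Lit (NegL p)) = neg (\<sigma> p)"
| "subst \<sigma> Bot = Bot"
| "subst \<sigma> Top = Top"
| "subst \<sigma> (And \<phi> \<psi>) = And (subst \<sigma> \<phi>) (subst \<sigma> \<psi>)"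
| "subst \<sigma> (Or \<phi> \<psi>) = Or (subst \<sigma> \<phi>) (subst \<sigma> \<psi>)"
| "subst \<sigma> (Dia \<phi>) = Dia (subst \<sigma> \<phi>)"
| "subst \<sigma> (Box \<phi>) = Box (subst \<sigma> \<phi>)"

definition subst_tuple :: "nat list \<Rightarrow> fm list \<Rightarrow> fm \<Rightarrow> fm" where
  "subst_tuple ps \<chi>s = subst (\<lambda>x. case map_of (zip ps \<chi>s) x of Some \<chi> \<Rightarrow> \<chi> | None \<Rightarrow> Var x)"

text \<open>Truth-functional evaluation in which the diamond formulas are treated as atoms, with
  \<open>d \<phi>\<close> the truth value of \<open>Dia \<phi>\<close>. As negation is expanded by duality, \<open>Box \<phi>\<close> is the negation
  of \<open>Dia (neg \<phi>)\<close>, so it is not a further independent atom. The formulas true under all such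
  evaluations are exactly the substitution instances of the modality-free tautologies.\<close>

fun eval :: "(nat \<Rightarrow> bool) \<Rightarrow> (fm \<Rightarrow> bool) \<Rightarrow> fm \<Rightarrow> bool" where
  "eval v d (Lit (PosL p)) = v p"
| "eval v d (Lit (NegL p)) = (\<not> v p)"
| "eval v d Bot = False"
| "eval v d Top = True"
| "eval v d (And \<phi> \<psi>) = (eval v d \<phi> \<and> eval v d \<psi>)"
| "eval v d (Or \<phi> \<psi>) = (eval v d \<phi> \<or> eval v d \<psi>)"
| "eval v d (Dia \<phi>) = d \<phi>"
| "eval v d (Box \<phi>) = (\<not> d (neg \<phi>))"

definition tautology :: "fm \<Rightarrow> bool" where
  "tautology \<phi> \<longleftrightarrow> (\<forall>v d. eval v d \<phi>)"

definition modal_logic :: "fm set \<Rightarrow> bool" where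
  "modal_logic \<Lambda> \<longleftrightarrow>
     (\<forall>\<phi>. tautology \<phi> \<longrightarrow> \<phi> \<in> \<Lambda>) \<and>
     (\<forall>\<phi> \<psi>. \<phi> \<in> \<Lambda> \<longrightarrow> Imp \<phi> \<psi> \<in> \<Lambda> \<longrightarrow> \<psi> \<in> \<Lambda>) \<and>
     (\<forall>\<sigma> \<phi>. \<phi> \<in> \<Lambda> \<longrightarrow> subst \<sigma> \<phi> \<in> \<Lambda>) \<and>
     (\<forall>\<phi> \<psi>. Iff \<phi> \<psi> \<in> \<Lambda> \<longrightarrow> Iff (Dia \<phi>) (Dia \<psi>) \<in> \<Lambda>)"

text \<open>\<open>modal_logic hull \<Gamma>\<close> is the smallest modal logic containing \<open>\<Gamma>\<close>, since modal logics are closed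
  under arbitrary intersections. The variables 0 and 1 play the roles of \<open>p\<close> and \<open>q\<close> in the axiom
  of EM.\<close>

definition EM :: "fm set" where
  "EM = modal_logic hull {Imp (Dia (Var 0)) (Dia (Or (Var 0) (Var 1)))}"

definition LIP :: "fm set \<Rightarrow> bool" where
  "LIP \<Lambda> \<longleftrightarrow>
     (\<forall>\<phi> \<psi>. Imp \<phi> \<psi> \<in> \<Lambda> \<longrightarrow>
       (\<exists>\<iota>. lits \<iota> \<subseteq> lits \<phi> \<inter> lits \<psi> \<and> Imp \<phi> \<iota> \<in> \<Lambda> \<and> Imp \<iota> \<psi> \<in> \<Lambda>))"

text \<open>As logics are closed under substitution, it is immaterial which tuple of fresh variables is
  used in the next definition.\<close>

definition monotone_in :: "fm set \<Rightarrow> nat list \<Rightarrow> nat list \<Rightarrow> fm \<Rightarrow> bool" where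
  "monotone_in \<Lambda> ps rs \<phi> \<longleftrightarrow>
     (\<exists>qs. length qs = length ps \<and> distinct qs \<and> set qs \<inter> (set ps \<union> set rs) = {} \<and>
       Imp \<phi> (subst_tuple ps (map2 (\<lambda>p q. Or (Var p) (Var q)) ps qs) \<phi>) \<in> \<Lambda>)"

definition LPP :: "fm set \<Rightarrow> bool" where
  "LPP \<Lambda> \<longleftrightarrow>
     (\<forall>ps rs \<phi>. distinct (ps @ rs) \<longrightarrow> vars \<phi> \<subseteq> set ps \<union> set rs \<longrightarrow> monotone_in \<Lambda> ps rs \<phi> \<longrightarrow>
       (\<exists>\<beta>. vars \<beta> \<subseteq> set ps \<union> set rs \<and> positive_in (set ps) \<beta> \<and> Iff \<phi> \<beta> \<in> \<Lambda>))"

end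

theory Submission
  imports Defs
begin

text \<open>
  The proof is a superamalgamation argument carried out on concrete neighbourhood frames.

  Call an evaluation that treats diamond formulas as atoms a \<open>\<Lambda>\<close>-assignment if it satisfies every
  theorem of \<open>\<Lambda>\<close>; these are the ultrafilters of the Lindenbaum algebra. Fix a set \<open>L\<close> of literals.
  The points of the frame are the pairs \<open>(a, b)\<close> of \<open>\<Lambda>\<close>-assignments such that every formula over
  \<open>L\<close> true in \<open>a\<close> is true in \<open>b\<close>. By compactness, if no formula over \<open>L\<close> lies between \<open>\<chi>\<close> and \<open>\<xi>\<close>
  in \<open>\<Lambda>\<close>, then some point \<open>(a, b)\<close> has \<open>\<chi>\<close> true in \<open>a\<close> and \<open>\<xi>\<close> false in \<open>b\<close>
  (lemma \<open>separation\<close>). So there are enough points to refute the existence of an interpolant.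

  Each formula \<open>\<chi>\<close> defines two sets of points, according to whether it is true on the left or on the
  right. The diamond is to be extended from these sets to all sets of points, and the crucial choice
  is the largest monotone extension: a point lies in \<open>\<Diamond>X\<close> iff it lies in \<open>\<Diamond>\<chi>\<close>, on the appropriate side,
  for every definable set \<open>\<chi>\<close> that includes \<open>X\<close>. Separation makes this an extension, so both
  projections are homomorphisms from formulas to sets of points (lemma \<open>sem_proj\<close>). It
  validates an axiom \<open>\<alpha>(p) \<rightarrow> \<Diamond>p\<close>: if \<open>X\<close> is included in the set defined by \<open>\<chi>\<close>, then, \<open>\<alpha>\<close> being
  positive, \<open>\<alpha>(X)\<close> is included in the set defined by \<open>\<alpha>(\<chi>)\<close> and hence in that of \<open>\<Diamond>\<chi>\<close>. Closed axioms do not see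
  the valuation at all. Hence \<open>\<Lambda>\<close> is sound for all valuations on this frame (lemma \<open>pair_frame_sound\<close>).

  For LIP let \<open>L\<close> be the set of common literals. If there were no interpolant, a point would satisfy
  \<open>\<phi>\<close> under the left valuation and refute \<open>\<psi>\<close> under the right one; a valuation that lies between the
  two, as far as the literals of \<open>\<phi>\<close> and \<open>\<psi>\<close> can tell, then refutes \<open>\<phi> \<rightarrow> \<psi>\<close>. For LPP let \<open>L\<close> consist of
  all literals over \<open>p, r\<close> but the negated \<open>p\<close>. Then the left valuation is below the right one
  on \<open>p\<close> and agrees with it on \<open>r\<close>, so monotonicity of \<open>\<phi>\<close> carries it from left to right, and a formula
  over \<open>L\<close> must lie between \<open>\<phi>\<close> and itself.
\<close>

section \<open>Propositional compactness\<close>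

abbreviation sat :: "(nat \<Rightarrow> bool) \<times> (fm \<Rightarrow> bool) \<Rightarrow> fm \<Rightarrow> bool" where
  "sat a \<phi> \<equiv> eval (fst a) (snd a) \<phi>"

definition satisfiable :: "fm set \<Rightarrow> bool" where
  "satisfiable T \<longleftrightarrow> (\<exists>a. \<forall>\<phi>\<in>T. sat a \<phi>)"

lemma unsatisfiableD: "\<not> satisfiable F \<Longrightarrow> \<exists>\<phi>\<in>F. \<not> sat a \<phi>"
  unfolding satisfiable_def by blast

lemma neg_lit_neg_lit [simp]: "neg_lit (neg_lit l) = l"
  by (cases l) auto

lemma neg_neg [simp]: "neg (neg \<phi>) = \<phi>"
  by (induction \<phi>) auto

lemma sat_neg [simp]: "sat a (neg \<phi>) \<longleftrightarrow> \<not> sat a \<phi>"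
proof (induction \<phi>)
  case (Lit l)
  then show ?case by (cases l) auto
qed auto

lemma sat_Imp [simp]: "sat a (Imp \<phi> \<psi>) \<longleftrightarrow> (sat a \<phi> \<longrightarrow> sat a \<psi>)"
  by (simp add: Imp_def)

lemma sat_Iff [simp]: "sat a (Iff \<phi> \<psi>) \<longleftrightarrow> (sat a \<phi> \<longleftrightarrow> sat a \<psi>)"
  by (auto simp: Iff_def)

text \<open>A maximal finitely satisfiable set decides every formula, so it can be read off as an
  assignment.\<close>

lemma compactness:
  assumes fin: "\<And>F. finite F \<Longrightarrow> F \<subseteq> T \<Longrightarrow> satisfiable F"
  shows "satisfiable T"
proof -
  define finsat where "finsat = (\<lambda>M. \<forall>F. finite F \<longrightarrow> F \<subseteq> M \<longrightarrow> satisfiable F)"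
  define C where "C = {M. T \<subseteq> M \<and> finsat M}"
  have "\<exists>M\<in>C. \<forall>X\<in>C. M \<subseteq> X \<longrightarrow> X = M"
  proof (rule subset_Zorn_nonempty)
    have "T \<in> C"
      using fin by (auto simp: C_def finsat_def)
    then show "C \<noteq> {}" by blast
  next
    fix K assume K: "K \<noteq> {}" "subset.chain C K"
    then have sub: "K \<subseteq> C"
      by (auto simp: subset.chain_def)
    have "satisfiable F" if F: "finite F" "F \<subseteq> \<Union>K" for F
    proof -
      obtain B where "B \<in> K" "F \<subseteq> B"
        using finite_subset_Union_chain[OF F K] by blast
      then show ?thesis
        using sub F(1) by (auto simp: C_def finsat_def)
    qed
    moreover have "T \<subseteq> \<Union>K"
      using K(1) sub by (auto simp: C_def)
    ultimately show "\<Union>K \<in> C"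
      by (auto simp: C_def finsat_def)
  qed
  then obtain M where MC: "M \<in> C" and max: "\<And>X. X \<in> C \<Longrightarrow> M \<subseteq> X \<Longrightarrow> X = M"
    by blast
  then have TM: "T \<subseteq> M" and M: "\<And>F. finite F \<Longrightarrow> F \<subseteq> M \<Longrightarrow> satisfiable F"
    by (auto simp: C_def finsat_def)
  have refuted: "\<exists>F. finite F \<and> F \<subseteq> M \<and> (\<forall>a. (\<forall>\<psi>\<in>F. sat a \<psi>) \<longrightarrow> \<not> sat a \<phi>)"
    if "\<phi> \<notin> M" for \<phi>
  proof -
    have "insert \<phi> M \<notin> C"
      using max[of "insert \<phi> M"] that by blast
    then obtain F where F: "finite F" "F \<subseteq> insert \<phi> M" "\<not> satisfiable F"
      using TM by (auto simp: C_def finsat_def)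
    have "finite (F - {\<phi>})" "F - {\<phi>} \<subseteq> M"
      using F by auto
    moreover have "\<forall>a. (\<forall>\<psi>\<in>F - {\<phi>}. sat a \<psi>) \<longrightarrow> \<not> sat a \<phi>"
      using F(3) by (auto simp: satisfiable_def)
    ultimately show ?thesis by blast
  qed
  have conseq: "\<phi> \<in> M" if "finite G" "G \<subseteq> M" "\<And>a. (\<forall>\<psi>\<in>G. sat a \<psi>) \<Longrightarrow> sat a \<phi>" for G \<phi>
  proof (rule ccontr)
    assume "\<phi> \<notin> M"
    then obtain F where F: "finite F" "F \<subseteq> M" "\<And>a. (\<forall>\<psi>\<in>F. sat a \<psi>) \<Longrightarrow> \<not> sat a \<phi>"
      using refuted by meson
    have "satisfiable (F \<union> G)"
      using M F that by simp
    then show False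
      unfolding satisfiable_def using F(3) that(3) by (metis UnCI)
  qed
  have cons: "\<not> (\<phi> \<in> M \<and> neg \<phi> \<in> M)" for \<phi>
  proof
    assume "\<phi> \<in> M \<and> neg \<phi> \<in> M"
    then have "satisfiable {\<phi>, neg \<phi>}"
      by (intro M) auto
    then show False
      by (auto simp: satisfiable_def)
  qed
  have neg_iff: "neg \<phi> \<in> M \<longleftrightarrow> \<phi> \<notin> M" for \<phi>
  proof
    assume "\<phi> \<notin> M"
    then obtain F where F: "finite F" "F \<subseteq> M" "\<And>a. (\<forall>\<psi>\<in>F. sat a \<psi>) \<Longrightarrow> \<not> sat a \<phi>"
      using refuted by meson
    then show "neg \<phi> \<in> M"
      by (intro conseq[of F]) auto
  qed (use cons in blast)
  have And_iff: "And \<phi> \<psi> \<in> M \<longleftrightarrow> \<phi> \<in> M \<and> \<psi> \<in> M" for \<phi> \<psi>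
  proof (intro iffI conjI)
    assume "And \<phi> \<psi> \<in> M"
    then show "\<phi> \<in> M" "\<psi> \<in> M"
      by (auto intro!: conseq[of "{And \<phi> \<psi>}"])
  next
    assume "\<phi> \<in> M \<and> \<psi> \<in> M"
    then show "And \<phi> \<psi> \<in> M"
      by (intro conseq[of "{\<phi>, \<psi>}"]) auto
  qed
  have Or_iff: "Or \<phi> \<psi> \<in> M \<longleftrightarrow> \<phi> \<in> M \<or> \<psi> \<in> M" for \<phi> \<psi>
    using And_iff[of "neg \<phi>" "neg \<psi>"] neg_iff[of "Or \<phi> \<psi>"] neg_iff[of \<phi>] neg_iff[of \<psi>] by auto
  have "sat (\<lambda>p. Var p \<in> M, \<lambda>\<phi>. Dia \<phi> \<in> M) \<phi> \<longleftrightarrow> \<phi> \<in> M" for \<phi>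
  proof (induction \<phi>)
    case (Lit l)
    then show ?case
      using neg_iff[of "Var (var_of l)"] by (cases l) auto
  next
    case Bot
    then show ?case
      using conseq[of "{}" Top] neg_iff[of Top] by simp
  next
    case Top
    then show ?case
      using conseq[of "{}" Top] by simp
  next
    case (Box \<phi>)
    then show ?case
      using neg_iff[of "Dia (neg \<phi>)"] by simp
  qed (simp_all add: And_iff Or_iff)
  then show ?thesis
    unfolding satisfiable_def using TM by blast
qed

lemma finite_conjunction:
  assumes "finite F" "\<And>\<phi>. \<phi> \<in> F \<Longrightarrow> lits \<phi> \<subseteq> L"
  shows "\<exists>\<theta>. lits \<theta> \<subseteq> L \<and> (\<forall>a. sat a \<theta> \<longleftrightarrow> (\<forall>\<phi>\<in>F. sat a \<phi>))"
  using assms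
proof (induction rule: finite_induct)
  case empty
  show ?case by (rule exI[of _ Top]) auto
next
  case (insert \<phi> F)
  then obtain \<theta> where "lits \<theta> \<subseteq> L" "\<forall>a. sat a \<theta> \<longleftrightarrow> (\<forall>\<phi>\<in>F. sat a \<phi>)"
    by auto
  then show ?case
    using insert.prems by (intro exI[of _ "And \<phi> \<theta>"]) auto
qed

lemma finite_disjunction:
  assumes "finite F" "\<And>\<phi>. \<phi> \<in> F \<Longrightarrow> lits \<phi> \<subseteq> L"
  shows "\<exists>\<theta>. lits \<theta> \<subseteq> L \<and> (\<forall>a. sat a \<theta> \<longleftrightarrow> (\<exists>\<phi>\<in>F. sat a \<phi>))"
  using assms
proof (induction rule: finite_induct)
  case empty
  show ?case by (rule exI[of _ Bot]) auto
next
  case (insert \<phi> F)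
  then obtain \<theta> where "lits \<theta> \<subseteq> L" "\<forall>a. sat a \<theta> \<longleftrightarrow> (\<exists>\<phi>\<in>F. sat a \<phi>)"
    by auto
  then show ?case
    using insert.prems by (intro exI[of _ "Or \<phi> \<theta>"]) auto
qed

section \<open>Neighbourhood semantics\<close>

text \<open>Complements are taken in the whole type and only the points in \<open>W\<close> count for validity.\<close>

fun sem :: "('w set \<Rightarrow> 'w set) \<Rightarrow> (nat \<Rightarrow> 'w set) \<Rightarrow> fm \<Rightarrow> 'w set" where
  "sem N V (Lit (PosL p)) = V p"
| "sem N V (Lit (NegL p)) = - V p"
| "sem N V Bot = {}"
| "sem N V Top = UNIV"
| "sem N V (And \<phi> \<psi>) = sem N V \<phi> \<inter> sem N V \<psi>"
| "sem N V (Or \<phi> \<psi>) = sem N V \<phi> \<union> sem N V \<psi>"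
| "sem N V (Dia \<phi>) = N (sem N V \<phi>)"
| "sem N V (Box \<phi>) = - N (- sem N V \<phi>)"

definition valid_on :: "'w set \<Rightarrow> ('w set \<Rightarrow> 'w set) \<Rightarrow> fm set" where
  "valid_on W N = {\<phi>. \<forall>V. W \<subseteq> sem N V \<phi>}"

text \<open>Besides monotonicity, this says that \<open>N\<close> depends only on the part of its argument
  inside \<open>W\<close>.\<close>

definition mono_frame :: "'w set \<Rightarrow> ('w set \<Rightarrow> 'w set) \<Rightarrow> bool" where
  "mono_frame W N \<longleftrightarrow> (\<forall>X Y. X \<inter> W \<subseteq> Y \<longrightarrow> N X \<subseteq> N Y)"

lemma mono_frameD: "mono_frame W N \<Longrightarrow> X \<inter> W \<subseteq> Y \<Longrightarrow> N X \<subseteq> N Y"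
  by (auto simp: mono_frame_def)

lemma mono_frame_cong:
  assumes "mono_frame W N" "X \<inter> W = Y \<inter> W"
  shows "N X = N Y"
  using mono_frameD[OF assms(1), of X Y] mono_frameD[OF assms(1), of Y X] assms(2) by blast

lemma sem_neg [simp]: "sem N V (neg \<phi>) = - sem N V \<phi>"
proof (induction \<phi>)
  case (Lit l)
  then show ?case by (cases l) auto
qed auto

lemma sem_Imp [simp]: "sem N V (Imp \<phi> \<psi>) = - sem N V \<phi> \<union> sem N V \<psi>"
  by (simp add: Imp_def)

lemma sem_subst: "sem N V (subst \<sigma> \<phi>) = sem N (\<lambda>p. sem N V (\<sigma> p)) \<phi>"
proof (induction \<phi>)
  case (Lit l)
  then show ?case by (cases l) auto
qed simp_all

lemma sem_mono:
  assumes "mono_frame W N"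
    and "\<And>l. l \<in> lits \<phi> \<Longrightarrow> sem N V (Lit l) \<inter> W \<subseteq> sem N V' (Lit l)"
  shows "sem N V \<phi> \<inter> W \<subseteq> sem N V' \<phi>"
  using assms(2)
proof (induction \<phi>)
  case (And \<phi> \<psi>)
  then have "sem N V \<phi> \<inter> W \<subseteq> sem N V' \<phi>" "sem N V \<psi> \<inter> W \<subseteq> sem N V' \<psi>"
    by auto
  then show ?case by auto
next
  case (Or \<phi> \<psi>)
  then have "sem N V \<phi> \<inter> W \<subseteq> sem N V' \<phi>" "sem N V \<psi> \<inter> W \<subseteq> sem N V' \<psi>"
    by auto
  then show ?case by auto
next
  case (Dia \<phi>)
  then have "sem N V \<phi> \<inter> W \<subseteq> sem N V' \<phi>" by auto
  then have "N (sem N V \<phi>) \<subseteq> N (sem N V' \<phi>)"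
    by (rule mono_frameD[OF assms(1)])
  then show ?case by auto
next
  case (Box \<phi>)
  then have "sem N V \<phi> \<inter> W \<subseteq> sem N V' \<phi>" by auto
  then have "(- sem N V' \<phi>) \<inter> W \<subseteq> - sem N V \<phi>" by blast
  then have "N (- sem N V' \<phi>) \<subseteq> N (- sem N V \<phi>)"
    by (rule mono_frameD[OF assms(1)])
  then show ?case by auto
qed auto

lemma sem_mono_vars:
  assumes "mono_frame W N" "\<And>p. p \<in> vars \<phi> \<Longrightarrow> V p \<inter> W = V' p \<inter> W"
  shows "sem N V \<phi> \<inter> W \<subseteq> sem N V' \<phi>"
proof (rule sem_mono[OF assms(1)])
  fix l assume "l \<in> lits \<phi>"
  then have "var_of l \<in> vars \<phi>"
    by (simp add: vars_def)
  then show "sem N V (Lit l) \<inter> W \<subseteq> sem N V' (Lit l)"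
    using assms(2)[of "var_of l"] by (cases l) auto
qed

lemma modal_logic_valid_on:
  assumes "mono_frame W N"
  shows "modal_logic (valid_on W N)"
  unfolding modal_logic_def
proof (intro conjI allI impI)
  fix \<phi> assume taut: "tautology \<phi>"
  have "eval (\<lambda>p. w \<in> V p) (\<lambda>\<psi>. w \<in> N (sem N V \<psi>)) \<psi> \<longleftrightarrow> w \<in> sem N V \<psi>" for w V \<psi>
  proof (induction \<psi>)
    case (Lit l)
    then show ?case by (cases l) auto
  qed auto
  then show "\<phi> \<in> valid_on W N"
    using taut unfolding tautology_def valid_on_def by blast
next
  fix \<phi> \<psi> assume "\<phi> \<in> valid_on W N" "Imp \<phi> \<psi> \<in> valid_on W N"
  then show "\<psi> \<in> valid_on W N"
    by (fastforce simp: valid_on_def)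
next
  fix \<sigma> \<phi> assume "\<phi> \<in> valid_on W N"
  then show "subst \<sigma> \<phi> \<in> valid_on W N"
    by (simp add: valid_on_def sem_subst)
next
  fix \<phi> \<psi> assume "Iff \<phi> \<psi> \<in> valid_on W N"
  then have "sem N V \<phi> \<inter> W = sem N V \<psi> \<inter> W" for V
    by (fastforce simp: valid_on_def Iff_def)
  then have "N (sem N V \<phi>) = N (sem N V \<psi>)" for V
    by (rule mono_frame_cong[OF assms])
  then show "Iff (Dia \<phi>) (Dia \<psi>) \<in> valid_on W N"
    by (auto simp: valid_on_def Iff_def)
qed

section \<open>Monotone modal logics\<close>

lemma modal_logic_hull: "modal_logic (modal_logic hull S)"
proof (rule hull_in)
  fix T assume T: "\<forall>s\<in>T. modal_logic s"
  show "modal_logic (\<Inter>T)"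
    unfolding modal_logic_def
  proof (intro conjI allI impI InterI)
    fix \<phi> s assume "tautology \<phi>" "s \<in> T"
    then have "tautology \<phi>" "modal_logic s"
      using T by auto
    then show "\<phi> \<in> s"
      unfolding modal_logic_def by blast
  next
    fix \<phi> \<psi> s assume "\<phi> \<in> \<Inter>T" "Imp \<phi> \<psi> \<in> \<Inter>T" "s \<in> T"
    then have "\<phi> \<in> s" "Imp \<phi> \<psi> \<in> s" "modal_logic s"
      using T by auto
    then show "\<psi> \<in> s"
      unfolding modal_logic_def by blast
  next
    fix \<sigma> \<phi> s assume "\<phi> \<in> \<Inter>T" "s \<in> T"
    then have "\<phi> \<in> s" "modal_logic s"
      using T by auto
    then show "subst \<sigma> \<phi> \<in> s"
      unfolding modal_logic_def by blast
  next
    fix \<phi> \<psi> s assume "Iff \<phi> \<psi> \<in> \<Inter>T" "s \<in> T"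
    then have "Iff \<phi> \<psi> \<in> s" "modal_logic s"
      using T by auto
    then show "Iff (Dia \<phi>) (Dia \<psi>) \<in> s"
      unfolding modal_logic_def by blast
  qed
qed

locale monotone_logic =
  fixes \<Lambda> :: "fm set"
  assumes logic: "modal_logic \<Lambda>"
    and mono_axiom: "Imp (Dia (Var 0)) (Dia (Or (Var 0) (Var 1))) \<in> \<Lambda>"
begin

definition assignment :: "(nat \<Rightarrow> bool) \<times> (fm \<Rightarrow> bool) \<Rightarrow> bool" where
  "assignment a \<longleftrightarrow> (\<forall>\<phi>\<in>\<Lambda>. sat a \<phi>)"

lemma modus_ponens: "\<phi> \<in> \<Lambda> \<Longrightarrow> Imp \<phi> \<psi> \<in> \<Lambda> \<Longrightarrow> \<psi> \<in> \<Lambda>"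
  and substitution: "\<phi> \<in> \<Lambda> \<Longrightarrow> subst \<sigma> \<phi> \<in> \<Lambda>"
  and congruence: "Iff \<phi> \<psi> \<in> \<Lambda> \<Longrightarrow> Iff (Dia \<phi>) (Dia \<psi>) \<in> \<Lambda>"
  using logic unfolding modal_logic_def by blast+

lemma finite_consequence:
  assumes "finite F" "F \<subseteq> \<Lambda>" "\<And>a. (\<forall>\<psi>\<in>F. sat a \<psi>) \<Longrightarrow> sat a \<phi>"
  shows "\<phi> \<in> \<Lambda>"
  using assms
proof (induction F arbitrary: \<phi> rule: finite_induct)
  case empty
  then have "tautology \<phi>"
    by (auto simp: tautology_def)
  then show ?case
    using logic unfolding modal_logic_def by blast
next
  case (insert \<psi> F)
  have "Imp \<psi> \<phi> \<in> \<Lambda>"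
    using insert.prems by (intro insert.IH) auto
  then show ?case
    using modus_ponens insert.prems by blast
qed

lemma completeness:
  assumes "\<And>a. assignment a \<Longrightarrow> sat a \<phi>"
  shows "\<phi> \<in> \<Lambda>"
proof -
  have "\<not> satisfiable (insert (neg \<phi>) \<Lambda>)"
    using assms by (auto simp: satisfiable_def assignment_def)
  then obtain F where F: "finite F" "F \<subseteq> insert (neg \<phi>) \<Lambda>" "\<not> satisfiable F"
    using compactness by blast
  show ?thesis
  proof (rule finite_consequence)
    show "finite (F - {neg \<phi>})" "F - {neg \<phi>} \<subseteq> \<Lambda>"
      using F by auto
    fix a assume "\<forall>\<psi>\<in>F - {neg \<phi>}. sat a \<psi>"
    then have "\<not> sat a (neg \<phi>)"
      using unsatisfiableD[OF F(3), of a] by blast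
    then show "sat a \<phi>"
      by simp
  qed
qed

lemma assignmentD:
  assumes "assignment a" "Imp \<phi> \<psi> \<in> \<Lambda>" "sat a \<phi>"
  shows "sat a \<psi>"
proof -
  have "sat a (Imp \<phi> \<psi>)"
    using assms(1,2) unfolding assignment_def by blast
  then show ?thesis
    using assms(3) by simp
qed

lemma Imp_neg:
  assumes "Imp \<phi> \<psi> \<in> \<Lambda>"
  shows "Imp (neg \<psi>) (neg \<phi>) \<in> \<Lambda>"
  by (rule finite_consequence[of "{Imp \<phi> \<psi>}"]) (use assms in auto)

text \<open>If \<open>\<phi> \<rightarrow> \<psi>\<close> is a theorem, then \<open>\<psi>\<close> is equivalent to \<open>\<phi> \<or> \<psi>\<close>, to which the monotonicity axiom
  applies.\<close>

lemma Dia_mono: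
  assumes "Imp \<phi> \<psi> \<in> \<Lambda>"
  shows "Imp (Dia \<phi>) (Dia \<psi>) \<in> \<Lambda>"
proof -
  have 1: "Imp (Dia \<phi>) (Dia (Or \<phi> \<psi>)) \<in> \<Lambda>"
    using substitution[OF mono_axiom, of "\<lambda>x. if x = 0 then \<phi> else \<psi>"] by (simp add: Imp_def)
  have "Iff (Or \<phi> \<psi>) \<psi> \<in> \<Lambda>"
    by (rule finite_consequence[of "{Imp \<phi> \<psi>}"]) (use assms in auto)
  then have 2: "Iff (Dia (Or \<phi> \<psi>)) (Dia \<psi>) \<in> \<Lambda>"
    by (rule congruence)
  show ?thesis
    by (rule finite_consequence[of "{Imp (Dia \<phi>) (Dia (Or \<phi> \<psi>)), Iff (Dia (Or \<phi> \<psi>)) (Dia \<psi>)}"])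
      (use 1 2 in auto)
qed

lemma Box_mono:
  assumes "Imp \<phi> \<psi> \<in> \<Lambda>"
  shows "Imp (Box \<phi>) (Box \<psi>) \<in> \<Lambda>"
proof -
  have "Imp (neg (Dia (neg \<phi>))) (neg (Dia (neg \<psi>))) \<in> \<Lambda>"
    by (intro Imp_neg Dia_mono assms)
  then show ?thesis by simp
qed

end

section \<open>The frame of pairs\<close>

locale pair_frame = monotone_logic +
  fixes L :: "lit set"
begin

definition points where
  "points = {(a, b). assignment a \<and> assignment b \<and> (\<forall>\<theta>. lits \<theta> \<subseteq> L \<longrightarrow> sat a \<theta> \<longrightarrow> sat b \<theta>)}"

definition left where
  "left \<chi> = {w :: ((nat \<Rightarrow> bool) \<times> (fm \<Rightarrow> bool)) \<times> ((nat \<Rightarrow> bool) \<times> (fm \<Rightarrow> bool)). sat (fst w) \<chi>}"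

definition right where
  "right \<chi> = {w :: ((nat \<Rightarrow> bool) \<times> (fm \<Rightarrow> bool)) \<times> ((nat \<Rightarrow> bool) \<times> (fm \<Rightarrow> bool)). sat (snd w) \<chi>}"

definition dia where
  "dia X = {w. \<forall>\<chi>. (X \<inter> points \<subseteq> left \<chi> \<longrightarrow> w \<in> left (Dia \<chi>)) \<and>
                    (X \<inter> points \<subseteq> right \<chi> \<longrightarrow> w \<in> right (Dia \<chi>))}"

lemma mono_frame_dia: "mono_frame points dia"
  unfolding mono_frame_def
proof (intro allI impI)
  fix X Y assume XY: "X \<inter> points \<subseteq> Y"
  have "X \<inter> points \<subseteq> Z" if "Y \<inter> points \<subseteq> Z" for Z
    using XY that by blast
  then show "dia X \<subseteq> dia Y"
    by (simp add: dia_def Collect_mono_iff)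
qed

text \<open>First choose \<open>b\<close> refuting \<open>\<xi>\<close> and satisfying all consequences of \<open>\<chi>\<close> over \<open>L\<close>, then \<open>a\<close>
  satisfying \<open>\<chi>\<close> and refuting every formula over \<open>L\<close> that fails in \<open>b\<close>. If compactness blocks the
  first choice, a conjunction is a separator; it cannot block the second one, since a disjunction
  would then be among the consequences satisfied by \<open>b\<close>.\<close>

lemma separation:
  assumes "points \<inter> left \<chi> \<subseteq> right \<xi>"
  shows "\<exists>\<theta>. lits \<theta> \<subseteq> L \<and> Imp \<chi> \<theta> \<in> \<Lambda> \<and> Imp \<theta> \<xi> \<in> \<Lambda>"
proof (rule ccontr)
  assume none: "\<not> ?thesis"
  define T where "T = {\<theta>. lits \<theta> \<subseteq> L \<and> Imp \<chi> \<theta> \<in> \<Lambda>}"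
  have "satisfiable (insert (neg \<xi>) (\<Lambda> \<union> T))"
  proof (rule compactness, rule ccontr)
    fix F assume F: "finite F" "F \<subseteq> insert (neg \<xi>) (\<Lambda> \<union> T)" "\<not> satisfiable F"
    have "\<exists>\<theta>. lits \<theta> \<subseteq> L \<and> (\<forall>a. sat a \<theta> \<longleftrightarrow> (\<forall>\<phi>\<in>F \<inter> T. sat a \<phi>))"
      by (rule finite_conjunction) (use F(1) in \<open>auto simp: T_def\<close>)
    then obtain \<theta> where \<theta>: "lits \<theta> \<subseteq> L" "\<And>a. sat a \<theta> \<longleftrightarrow> (\<forall>\<phi>\<in>F \<inter> T. sat a \<phi>)"
      by blast
    have "Imp \<chi> \<theta> \<in> \<Lambda>"
    proof (rule completeness)
      fix a assume a: "assignment a"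
      have "sat a \<phi>" if "\<phi> \<in> T" "sat a \<chi>" for \<phi>
        using that assignmentD[OF a] unfolding T_def by blast
      then show "sat a (Imp \<chi> \<theta>)"
        using \<theta>(2) by simp
    qed
    moreover have "Imp \<theta> \<xi> \<in> \<Lambda>"
    proof (rule completeness)
      fix a assume a: "assignment a"
      obtain \<phi> where \<phi>: "\<phi> \<in> F" "\<not> sat a \<phi>"
        using unsatisfiableD[OF F(3)] by blast
      then have "\<phi> = neg \<xi> \<or> \<phi> \<in> T"
        using F(2) a unfolding assignment_def by blast
      then show "sat a (Imp \<theta> \<xi>)"
        using \<phi> \<theta>(2)[of a] by auto
    qed
    ultimately show False
      using none \<theta>(1) by blast
  qed
  then obtain b where b': "\<And>\<theta>. \<theta> \<in> insert (neg \<xi>) (\<Lambda> \<union> T) \<Longrightarrow> sat b \<theta>"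
    unfolding satisfiable_def by blast
  then have b: "assignment b" "\<And>\<theta>. \<theta> \<in> T \<Longrightarrow> sat b \<theta>" "\<not> sat b \<xi>"
    using b'[of "neg \<xi>"] by (simp_all add: assignment_def)
  define U where "U = {\<theta>. lits \<theta> \<subseteq> L \<and> \<not> sat b \<theta>}"
  have "satisfiable (insert \<chi> (\<Lambda> \<union> neg ` U))"
  proof (rule compactness, rule ccontr)
    fix F assume F: "finite F" "F \<subseteq> insert \<chi> (\<Lambda> \<union> neg ` U)" "\<not> satisfiable F"
    have "U \<inter> {\<theta>. neg \<theta> \<in> F} \<subseteq> neg ` F"
    proof
      fix \<theta> assume "\<theta> \<in> U \<inter> {\<theta>. neg \<theta> \<in> F}"
      then have "neg (neg \<theta>) \<in> neg ` F"
        by blast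
      then show "\<theta> \<in> neg ` F"
        by simp
    qed
    then have "finite (U \<inter> {\<theta>. neg \<theta> \<in> F})"
      using F(1) finite_surj by blast
    then have "\<exists>\<theta>. lits \<theta> \<subseteq> L \<and> (\<forall>a. sat a \<theta> \<longleftrightarrow> (\<exists>\<phi>\<in>U \<inter> {\<theta>. neg \<theta> \<in> F}. sat a \<phi>))"
      by (rule finite_disjunction) (simp add: U_def)
    then obtain \<theta> where \<theta>: "lits \<theta> \<subseteq> L" "\<And>a. sat a \<theta> \<longleftrightarrow> (\<exists>\<phi>\<in>U \<inter> {\<theta>. neg \<theta> \<in> F}. sat a \<phi>)"
      by blast
    have "Imp \<chi> \<theta> \<in> \<Lambda>"
    proof (rule completeness)
      fix a assume a: "assignment a"
      obtain \<phi> where \<phi>: "\<phi> \<in> F" "\<not> sat a \<phi>"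
        using unsatisfiableD[OF F(3)] by blast
      then have "\<phi> = \<chi> \<or> \<phi> \<in> neg ` U"
        using F(2) a unfolding assignment_def by blast
      then show "sat a (Imp \<chi> \<theta>)"
        using \<phi> \<theta>(2)[of a] by auto
    qed
    then have "sat b \<theta>"
      using b(2) \<theta>(1) by (simp add: T_def)
    then show False
      using \<theta>(2)[of b] by (auto simp: U_def)
  qed
  then obtain a where a': "\<And>\<theta>. \<theta> \<in> insert \<chi> (\<Lambda> \<union> neg ` U) \<Longrightarrow> sat a \<theta>"
    unfolding satisfiable_def by blast
  have a: "assignment a" "sat a \<chi>"
    using a' by (simp_all add: assignment_def)
  have "\<not> sat a \<theta>" if "\<theta> \<in> U" for \<theta>
    using a'[of "neg \<theta>"] that by simp
  then have "(a, b) \<in> points"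
    using a(1) b(1) unfolding points_def U_def by blast
  moreover have "(a, b) \<in> left \<chi>" "(a, b) \<notin> right \<xi>"
    using a(2) b(3) by (simp_all add: left_def right_def)
  ultimately show False
    using assms by blast
qed

text \<open>The diagonal consists of points, so on one side inclusion of definable sets is
  provable implication.\<close>

lemma left_subset_left:
  assumes "points \<inter> left \<chi> \<subseteq> left \<xi>"
  shows "Imp \<chi> \<xi> \<in> \<Lambda>"
proof (rule completeness)
  fix a assume "assignment a"
  then have "(a, a) \<in> points"
    by (simp add: points_def)
  then have "(a, a) \<in> left \<chi> \<longrightarrow> (a, a) \<in> left \<xi>"
    using assms by blast
  then show "sat a (Imp \<chi> \<xi>)"
    by (simp add: left_def)
qed

lemma right_subset_right:
  assumes "points \<inter> right \<chi> \<subseteq> right \<xi>"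
  shows "Imp \<chi> \<xi> \<in> \<Lambda>"
proof (rule completeness)
  fix a assume "assignment a"
  then have "(a, a) \<in> points"
    by (simp add: points_def)
  then have "(a, a) \<in> right \<chi> \<longrightarrow> (a, a) \<in> right \<xi>"
    using assms by blast
  then show "sat a (Imp \<chi> \<xi>)"
    by (simp add: right_def)
qed

lemma left_Dia_subset_right_Dia:
  assumes "points \<inter> left \<chi> \<subseteq> right \<xi>"
  shows "points \<inter> left (Dia \<chi>) \<subseteq> right (Dia \<xi>)"
proof -
  obtain \<theta> where \<theta>: "lits \<theta> \<subseteq> L" "Imp \<chi> \<theta> \<in> \<Lambda>" "Imp \<theta> \<xi> \<in> \<Lambda>"
    using separation[OF assms] by blast
  have \<theta>': "lits (Dia \<theta>) \<subseteq> L"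
    using \<theta>(1) by simp
  show ?thesis
  proof
    fix w assume w: "w \<in> points \<inter> left (Dia \<chi>)"
    obtain a b where ab: "w = (a, b)" "assignment a" "assignment b" "sat a (Dia \<theta>) \<longrightarrow> sat b (Dia \<theta>)"
      using w \<theta>' unfolding points_def by blast
    have "sat a (Dia \<chi>)"
      using w ab(1) by (simp add: left_def)
    then have "sat b (Dia \<xi>)"
      using ab assignmentD[OF _ Dia_mono[OF \<theta>(2)]] assignmentD[OF _ Dia_mono[OF \<theta>(3)]] by blast
    then show "w \<in> right (Dia \<xi>)"
      using ab(1) by (simp add: right_def)
  qed
qed

text \<open>Truth of formulas over \<open>L\<close> passes from left to right and so falsity passes from right to left.
  The separator therefore has to be sought between the negations, and a box takes the place of
  the diamond.\<close>

lemma right_Dia_subset_left_Dia: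
  assumes "points \<inter> right \<chi> \<subseteq> left \<xi>"
  shows "points \<inter> right (Dia \<chi>) \<subseteq> left (Dia \<xi>)"
proof -
  have "points \<inter> left (neg \<xi>) \<subseteq> right (neg \<chi>)"
    using assms by (auto simp: left_def right_def)
  then obtain \<theta> where \<theta>: "lits \<theta> \<subseteq> L" "Imp (neg \<xi>) \<theta> \<in> \<Lambda>" "Imp \<theta> (neg \<chi>) \<in> \<Lambda>"
    using separation by blast
  have \<theta>': "lits (Box \<theta>) \<subseteq> L"
    using \<theta>(1) by simp
  show ?thesis
  proof
    fix w assume w: "w \<in> points \<inter> right (Dia \<chi>)"
    obtain a b where ab: "w = (a, b)" "assignment a" "assignment b" "sat a (Box \<theta>) \<longrightarrow> sat b (Box \<theta>)"
      using w \<theta>' unfolding points_def by blast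
    have "\<not> sat b (Box (neg \<chi>))"
      using w ab(1) by (simp add: right_def)
    then have "\<not> sat a (Box \<theta>)"
      using ab assignmentD[OF _ Box_mono[OF \<theta>(3)]] by blast
    then have "\<not> sat a (Box (neg \<xi>))"
      using ab assignmentD[OF _ Box_mono[OF \<theta>(2)]] by blast
    then show "w \<in> left (Dia \<xi>)"
      using ab(1) by (simp add: left_def)
  qed
qed

lemma dia_left: "dia (left \<chi>) \<inter> points = left (Dia \<chi>) \<inter> points"
proof
  show "dia (left \<chi>) \<inter> points \<subseteq> left (Dia \<chi>) \<inter> points"
    unfolding dia_def by blast
  have "w \<in> left (Dia \<xi>)" if "w \<in> points" "w \<in> left (Dia \<chi>)" "points \<inter> left \<chi> \<subseteq> left \<xi>" for w \<xi>
    using assignmentD[OF _ Dia_mono[OF left_subset_left[OF that(3)]]] that(1,2)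
    unfolding points_def left_def by auto
  then show "left (Dia \<chi>) \<inter> points \<subseteq> dia (left \<chi>) \<inter> points"
    using left_Dia_subset_right_Dia[of \<chi>] unfolding dia_def by (simp add: subset_iff)
qed

lemma dia_right: "dia (right \<chi>) \<inter> points = right (Dia \<chi>) \<inter> points"
proof
  show "dia (right \<chi>) \<inter> points \<subseteq> right (Dia \<chi>) \<inter> points"
    unfolding dia_def by blast
  have "w \<in> right (Dia \<xi>)" if "w \<in> points" "w \<in> right (Dia \<chi>)" "points \<inter> right \<chi> \<subseteq> right \<xi>" for w \<xi>
    using assignmentD[OF _ Dia_mono[OF right_subset_right[OF that(3)]]] that(1,2)
    unfolding points_def right_def by auto
  then show "right (Dia \<chi>) \<inter> points \<subseteq> dia (right \<chi>) \<inter> points"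
    using right_Dia_subset_left_Dia[of \<chi>] unfolding dia_def by (simp add: subset_iff)
qed

text \<open>The argument is the same for \<open>left\<close> and \<open>right\<close>: it uses only that they are Boolean
  homomorphisms and that \<open>dia\<close> extends the diamond.\<close>

lemma sem_proj:
  assumes proj: "proj = left \<or> proj = right"
  shows "sem dia (\<lambda>p. proj (Var p)) \<phi> \<inter> points = proj \<phi> \<inter> points"
proof -
  have dia: "dia (proj \<chi>) \<inter> points = proj (Dia \<chi>) \<inter> points" for \<chi>
    using proj dia_left dia_right by auto
  have neg: "proj (neg \<chi>) = - proj \<chi>" for \<chi>
    using proj by (auto simp: left_def right_def)
  show ?thesis
  proof (induction \<phi>)
    case (Lit l)
    then show ?case
      using neg[of "Var (var_of l)"] by (cases l) auto
  next
    case Bot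
    then show ?case using proj by (auto simp: left_def right_def)
  next
    case Top
    then show ?case using proj by (auto simp: left_def right_def)
  next
    case (And \<phi> \<psi>)
    moreover have "proj (And \<phi> \<psi>) = proj \<phi> \<inter> proj \<psi>"
      using proj by (auto simp: left_def right_def)
    ultimately show ?case by auto
  next
    case (Or \<phi> \<psi>)
    moreover have "proj (Or \<phi> \<psi>) = proj \<phi> \<union> proj \<psi>"
      using proj by (auto simp: left_def right_def)
    ultimately show ?case by auto
  next
    case (Dia \<phi>)
    then have "dia (sem dia (\<lambda>p. proj (Var p)) \<phi>) = dia (proj \<phi>)"
      by (rule mono_frame_cong[OF mono_frame_dia])
    then show ?case
      using dia by simp
  next
    case (Box \<phi>)
    then have "(- sem dia (\<lambda>p. proj (Var p)) \<phi>) \<inter> points = proj (neg \<phi>) \<inter> points"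
      unfolding neg by blast
    then have "dia (- sem dia (\<lambda>p. proj (Var p)) \<phi>) = dia (proj (neg \<phi>))"
      by (rule mono_frame_cong[OF mono_frame_dia])
    moreover have "proj (Box \<phi>) = - proj (Dia (neg \<phi>))"
      using neg[of "Dia (neg \<phi>)"] by simp
    ultimately show ?case
      using dia[of "neg \<phi>"] by auto
  qed
qed

lemma theorem_on_points:
  assumes "\<phi> \<in> \<Lambda>" "proj = left \<or> proj = right"
  shows "points \<subseteq> proj \<phi>"
  using assms by (auto simp: points_def assignment_def left_def right_def)

lemma closed_valid:
  assumes "closed_fm \<gamma>" "\<gamma> \<in> \<Lambda>"
  shows "\<gamma> \<in> valid_on points dia"
proof -
  have "points \<subseteq> sem dia V \<gamma>" for V
  proof -
    have "sem dia (\<lambda>p. left (Var p)) \<gamma> \<inter> points \<subseteq> sem dia V \<gamma>"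
      using assms(1) by (intro sem_mono_vars[OF mono_frame_dia]) (auto simp: closed_fm_def)
    then show ?thesis
      using sem_proj[of left \<gamma>] theorem_on_points[OF assms(2), of left] by auto
  qed
  then show ?thesis
    by (simp add: valid_on_def)
qed

text \<open>An upper bound \<open>\<chi>\<close> of \<open>X\<close> yields the upper bound \<open>\<alpha>(\<chi>)\<close> of \<open>\<alpha>(X)\<close>, as \<open>\<alpha>\<close> is positive.\<close>

lemma positive_axiom_valid:
  assumes pos: "positive \<alpha>" and vars: "vars \<alpha> \<subseteq> {p}" and derivable: "Imp \<alpha> (Dia (Var p)) \<in> \<Lambda>"
  shows "Imp \<alpha> (Dia (Var p)) \<in> valid_on points dia"
proof -
  have bound: "w \<in> proj (Dia \<chi>)"
    if w: "w \<in> points" "w \<in> sem dia V \<alpha>" and V: "V p \<inter> points \<subseteq> proj \<chi>"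
      and proj: "proj = left \<or> proj = right" for w V \<chi> proj
  proof -
    let ?\<sigma> = "\<lambda>_ :: nat. \<chi>"
    let ?V = "\<lambda>x. proj (Var x)"
    have "sem dia V \<alpha> \<inter> points \<subseteq> sem dia (\<lambda>x. sem dia ?V (?\<sigma> x)) \<alpha>"
    proof (rule sem_mono[OF mono_frame_dia])
      fix l assume l: "l \<in> lits \<alpha>"
      then have "l = PosL p"
        using pos vars by (cases l) (auto simp: positive_def positive_in_def vars_def)
      then show "sem dia V (Lit l) \<inter> points \<subseteq> sem dia (\<lambda>x. sem dia ?V (?\<sigma> x)) (Lit l)"
        using V sem_proj[OF proj, of \<chi>] by auto
    qed
    then have "w \<in> proj (subst ?\<sigma> \<alpha>)"
      using w sem_proj[OF proj, of "subst ?\<sigma> \<alpha>"] by (auto simp: sem_subst)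
    moreover have "points \<subseteq> proj (subst ?\<sigma> (Imp \<alpha> (Dia (Var p))))"
      using theorem_on_points[OF substitution[OF derivable] proj] .
    moreover have "sat a (subst ?\<sigma> (Imp \<alpha> (Dia (Var p)))) \<longleftrightarrow>
        (sat a (subst ?\<sigma> \<alpha>) \<longrightarrow> sat a (Dia \<chi>))" for a
    proof -
      have "subst ?\<sigma> (neg \<phi>) = neg (subst ?\<sigma> \<phi>)" for \<phi>
      proof (induction \<phi>)
        case (Lit l)
        then show ?case by (cases l) auto
      qed auto
      then show ?thesis by (simp add: Imp_def)
    qed
    ultimately show ?thesis
      using w(1) proj unfolding left_def right_def by blast
  qed
  have "w \<in> dia (V p)" if "w \<in> points" "w \<in> sem dia V \<alpha>" for w V
    unfolding dia_def using bound[OF that, of left] bound[OF that, of right] by simp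
  then show ?thesis
    by (auto simp: valid_on_def)
qed

lemma pair_frame_sound:
  assumes "\<Lambda> = modal_logic hull (EM \<union> \<Gamma>)"
    and \<Gamma>: "\<And>\<gamma>. \<gamma> \<in> \<Gamma> \<Longrightarrow>
      closed_fm \<gamma> \<or> (\<exists>\<alpha> p. positive \<alpha> \<and> vars \<alpha> \<subseteq> {p} \<and> \<gamma> = Imp \<alpha> (Dia (Var p)))"
  shows "\<Lambda> \<subseteq> valid_on points dia"
proof -
  have logic': "modal_logic (valid_on points dia)"
    by (rule modal_logic_valid_on[OF mono_frame_dia])
  have "dia (V 0) \<subseteq> dia (V 0 \<union> V 1)" for V :: "nat \<Rightarrow> _"
    by (rule mono_frameD[OF mono_frame_dia]) blast
  then have "Imp (Dia (Var 0)) (Dia (Or (Var 0) (Var 1))) \<in> valid_on points dia"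
    by (auto simp: valid_on_def)
  then have "EM \<subseteq> valid_on points dia"
    unfolding EM_def using logic' by (intro hull_minimal) auto
  moreover have "\<Gamma> \<subseteq> \<Lambda>"
    using hull_subset[of "EM \<union> \<Gamma>" modal_logic] unfolding assms(1) by blast
  then have "\<Gamma> \<subseteq> valid_on points dia"
    using \<Gamma> closed_valid positive_axiom_valid by blast
  ultimately have "modal_logic hull (EM \<union> \<Gamma>) \<subseteq> valid_on points dia"
    by (intro hull_minimal logic') blast
  then show ?thesis
    by (simp add: assms(1)[symmetric])
qed

lemma separation_by_semantics:
  assumes "points \<inter> sem dia (\<lambda>p. left (Var p)) \<chi> \<subseteq> sem dia (\<lambda>p. right (Var p)) \<xi>"
  shows "\<exists>\<theta>. lits \<theta> \<subseteq> L \<and> Imp \<chi> \<theta> \<in> \<Lambda> \<and> Imp \<theta> \<xi> \<in> \<Lambda>"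
  using assms sem_proj[of left \<chi>] sem_proj[of right \<xi>] by (intro separation) auto

lemma literal_left_right:
  assumes "(a, b) \<in> points" "l \<in> L" "sat a (Lit l)"
  shows "sat b (Lit l)"
proof -
  have "lits (Lit l) \<subseteq> L"
    using assms(2) by simp
  then show ?thesis
    using assms(1,3) unfolding points_def by blast
qed

end

section \<open>Interpolation and positivity\<close>

text \<open>The valuation \<open>V\<close> makes \<open>p\<close> true where either side demands it: where \<open>p\<close> occurs in \<open>\<phi>\<close> and is true
  on the left, or \<open>\<not>p\<close> occurs in \<open>\<psi>\<close> and is false on the right. The common literals being preserved from
  left to right, these demands never conflict with those for falsity.\<close>

lemma lyndon_interpolant:
  assumes "monotone_logic \<Lambda>"
    and sound: "\<Lambda> \<subseteq> valid_on (pair_frame.points \<Lambda> (lits \<phi> \<inter> lits \<psi>))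
                     (pair_frame.dia \<Lambda> (lits \<phi> \<inter> lits \<psi>))"
    and derivable: "Imp \<phi> \<psi> \<in> \<Lambda>"
  shows "\<exists>\<iota>. lits \<iota> \<subseteq> lits \<phi> \<inter> lits \<psi> \<and> Imp \<phi> \<iota> \<in> \<Lambda> \<and> Imp \<iota> \<psi> \<in> \<Lambda>"
proof -
  interpret pair_frame \<Lambda> "lits \<phi> \<inter> lits \<psi>"
    using assms(1) by (simp add: pair_frame_def)
  define V where "V p = {(a, b). PosL p \<in> lits \<phi> \<and> sat a (Var p) \<or>
                                 NegL p \<in> lits \<psi> \<and> sat b (Var p)}" for p
  have "sem dia (\<lambda>p. left (Var p)) \<phi> \<inter> points \<subseteq> sem dia V \<phi>"
  proof (rule sem_mono[OF mono_frame_dia])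
    fix l assume l: "l \<in> lits \<phi>"
    show "sem dia (\<lambda>p. left (Var p)) (Lit l) \<inter> points \<subseteq> sem dia V (Lit l)"
    proof
      fix w assume w: "w \<in> sem dia (\<lambda>p. left (Var p)) (Lit l) \<inter> points"
      obtain a b where ab: "w = (a, b)" by (cases w)
      have "l \<in> lits \<psi> \<Longrightarrow> sat a (Lit l) \<Longrightarrow> sat b (Lit l)"
        using literal_left_right[of a b l] l w ab by blast
      then show "w \<in> sem dia V (Lit l)"
        using w l unfolding ab by (cases l) (auto simp: V_def left_def)
    qed
  qed
  moreover have "sem dia V \<psi> \<inter> points \<subseteq> sem dia (\<lambda>p. right (Var p)) \<psi>"
  proof (rule sem_mono[OF mono_frame_dia])
    fix l assume l: "l \<in> lits \<psi>"
    show "sem dia V (Lit l) \<inter> points \<subseteq> sem dia (\<lambda>p. right (Var p)) (Lit l)"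
    proof
      fix w assume w: "w \<in> sem dia V (Lit l) \<inter> points"
      obtain a b where ab: "w = (a, b)" by (cases w)
      have "l \<in> lits \<phi> \<Longrightarrow> sat a (Lit l) \<Longrightarrow> sat b (Lit l)"
        using literal_left_right[of a b l] l w ab by blast
      then show "w \<in> sem dia (\<lambda>p. right (Var p)) (Lit l)"
        using w l unfolding ab by (cases l) (auto simp: V_def right_def)
    qed
  qed
  moreover have "points \<inter> sem dia V \<phi> \<subseteq> sem dia V \<psi>"
    using sound derivable by (fastforce simp: valid_on_def)
  ultimately show ?thesis
    by (intro separation_by_semantics) blast
qed

text \<open>If \<open>V\<close> is below \<open>V'\<close> on \<open>ps\<close>, then interpreting the fresh variables \<open>qs\<close> by the values of \<open>V'\<close> at
  \<open>ps\<close> turns \<open>ps \<or> qs\<close> into \<open>V'\<close> at \<open>ps\<close>.\<close>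

lemma monotone_in_sem:
  assumes frame: "mono_frame W N" and sound: "\<Lambda> \<subseteq> valid_on W N"
    and mono: "monotone_in \<Lambda> ps rs \<phi>"
    and vars: "vars \<phi> \<subseteq> set ps \<union> set rs" and dist: "distinct (ps @ rs)"
    and ps: "\<And>p. p \<in> set ps \<Longrightarrow> V p \<inter> W \<subseteq> V' p"
    and rs: "\<And>r. r \<in> set rs \<Longrightarrow> V r \<inter> W = V' r \<inter> W"
  shows "W \<inter> sem N V \<phi> \<subseteq> sem N V' \<phi>"
proof -
  obtain qs where qs: "length qs = length ps" "distinct qs" "set qs \<inter> (set ps \<union> set rs) = {}"
    and derivable: "Imp \<phi> (subst_tuple ps (map2 (\<lambda>p q. Or (Var p) (Var q)) ps qs) \<phi>) \<in> \<Lambda>"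
    using mono by (auto simp: monotone_in_def)
  let ?\<chi>s = "map2 (\<lambda>p q. Or (Var p) (Var q)) ps qs"
  define \<sigma> where "\<sigma> = (\<lambda>x. case map_of (zip ps ?\<chi>s) x of Some \<chi> \<Rightarrow> \<chi> | None \<Rightarrow> Var x)"
  define U where "U = (\<lambda>x. case map_of (zip qs ps) x of Some p \<Rightarrow> V' p | None \<Rightarrow> V x)"
  have U: "U x = V x" if "x \<in> set ps \<union> set rs" for x
  proof -
    have "map_of (zip qs ps) x = None"
      using qs that by (subst map_of_zip_is_None) auto
    then show ?thesis by (simp add: U_def)
  qed
  have \<sigma>_p: "sem N U (\<sigma> p) = V p \<union> V' p" if p: "p \<in> set ps" for p
  proof -
    obtain i where i: "i < length ps" "p = ps ! i"
      using p by (auto simp: in_set_conv_nth)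
    have "map_of (zip ps ?\<chi>s) (ps ! i) = Some (?\<chi>s ! i)"
      using i dist qs by (intro map_of_zip_nth) auto
    then have "\<sigma> p = Or (Var p) (Var (qs ! i))"
      using i qs by (simp add: \<sigma>_def)
    moreover have "map_of (zip qs ps) (qs ! i) = Some (ps ! i)"
      using i qs by (intro map_of_zip_nth) auto
    then have "U (qs ! i) = V' p"
      using i by (simp add: U_def)
    ultimately show ?thesis
      using U p by simp
  qed
  have \<sigma>_r: "sem N U (\<sigma> r) = V r" if r: "r \<in> set rs" for r
  proof -
    have "map_of (zip ps ?\<chi>s) r = None"
      using r dist qs by (subst map_of_zip_is_None) auto
    then show ?thesis
      using U r by (simp add: \<sigma>_def)
  qed
  have "sem N V \<phi> \<inter> W \<subseteq> sem N U \<phi>"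
    using U vars by (intro sem_mono_vars[OF frame]) auto
  moreover have "W \<inter> sem N U \<phi> \<subseteq> sem N U (subst \<sigma> \<phi>)"
    using sound derivable by (fastforce simp: valid_on_def subst_tuple_def \<sigma>_def)
  moreover have "sem N (\<lambda>x. sem N U (\<sigma> x)) \<phi> \<inter> W \<subseteq> sem N V' \<phi>"
  proof (rule sem_mono_vars[OF frame])
    fix x assume "x \<in> vars \<phi>"
    then consider "x \<in> set ps" | "x \<in> set rs"
      using vars by blast
    then show "sem N U (\<sigma> x) \<inter> W = V' x \<inter> W"
      by cases (use \<sigma>_p ps \<sigma>_r rs in blast)+
  qed
  ultimately show ?thesis
    unfolding sem_subst by blast
qed

lemma lyndon_positive_equivalent:
  fixes ps rs :: "nat list"
  defines "L \<equiv> {l. var_of l \<in> set ps \<union> set rs \<and> l \<notin> NegL ` set ps}"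
  assumes "monotone_logic \<Lambda>"
    and sound: "\<Lambda> \<subseteq> valid_on (pair_frame.points \<Lambda> L) (pair_frame.dia \<Lambda> L)"
    and mono: "monotone_in \<Lambda> ps rs \<phi>"
    and vars: "vars \<phi> \<subseteq> set ps \<union> set rs" and dist: "distinct (ps @ rs)"
  shows "\<exists>\<beta>. vars \<beta> \<subseteq> set ps \<union> set rs \<and> positive_in (set ps) \<beta> \<and> Iff \<phi> \<beta> \<in> \<Lambda>"
proof -
  interpret pair_frame \<Lambda> L
    using assms(2) by (simp add: pair_frame_def)
  have PosL: "PosL x \<in> L" if "x \<in> set ps \<union> set rs" for x
    using that by (auto simp: L_def)
  have NegL: "NegL r \<in> L" if "r \<in> set rs" for r
    using that dist by (auto simp: L_def)
  have "points \<inter> sem dia (\<lambda>p. left (Var p)) \<phi> \<subseteq> sem dia (\<lambda>p. right (Var p)) \<phi>"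
  proof (rule monotone_in_sem[OF mono_frame_dia sound mono vars dist])
    fix p assume p: "p \<in> set ps"
    show "left (Var p) \<inter> points \<subseteq> right (Var p)"
      using literal_left_right[OF _ PosL[of p]] p by (auto simp: left_def right_def)
  next
    fix r assume r: "r \<in> set rs"
    have "sat (fst w) (Var r) \<longleftrightarrow> sat (snd w) (Var r)" if "w \<in> points" for w
      using literal_left_right[of "fst w" "snd w" "PosL r"]
        literal_left_right[of "fst w" "snd w" "NegL r"] PosL[of r] NegL[of r] r that by auto
    then show "left (Var r) \<inter> points = right (Var r) \<inter> points"
      unfolding left_def right_def by blast
  qed
  then obtain \<theta> where \<theta>: "lits \<theta> \<subseteq> L" "Imp \<phi> \<theta> \<in> \<Lambda>" "Imp \<theta> \<phi> \<in> \<Lambda>"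
    using separation_by_semantics by blast
  have "Iff \<phi> \<theta> \<in> \<Lambda>"
    by (rule finite_consequence[of "{Imp \<phi> \<theta>, Imp \<theta> \<phi>}"]) (use \<theta> in auto)
  then show ?thesis
    using \<theta>(1) by (intro exI[of _ \<theta>]) (auto simp: L_def vars_def positive_in_def)
qed

theorem corollary5p8:
  fixes \<Lambda> \<Gamma> :: "fm set"
  assumes "\<And>\<gamma>. \<gamma> \<in> \<Gamma> \<Longrightarrow>
      closed_fm \<gamma> \<or>
      (\<exists>\<alpha> p. positive \<alpha> \<and> vars \<alpha> \<subseteq> {p} \<and> \<gamma> = Imp \<alpha> (Dia (Var p)))"
    and "\<Lambda> = modal_logic hull (EM \<union> \<Gamma>)"
  shows "LIP \<Lambda> \<and> LPP \<Lambda>"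
proof -
  have "Imp (Dia (Var 0)) (Dia (Or (Var 0) (Var 1))) \<in> EM"
    unfolding EM_def by (rule hull_inc) simp
  then have "Imp (Dia (Var 0)) (Dia (Or (Var 0) (Var 1))) \<in> \<Lambda>"
    unfolding assms(2) by (intro hull_inc) simp
  then have ml: "monotone_logic \<Lambda>"
    using modal_logic_hull unfolding assms(2) by unfold_locales
  then have sound: "\<Lambda> \<subseteq> valid_on (pair_frame.points \<Lambda> L) (pair_frame.dia \<Lambda> L)" for L
    using pair_frame.pair_frame_sound[of \<Lambda> \<Gamma> L] assms by (simp add: pair_frame_def)
  have "LIP \<Lambda>"
    unfolding LIP_def using lyndon_interpolant[OF ml sound] by blast
  moreover have "LPP \<Lambda>"
    unfolding LPP_def using lyndon_positive_equivalent[OF ml sound] by blast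
  ultimately show ?thesis ..
qed

end
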